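(* Let $r \ge 2$ and $t \ge 1$ be integers. Every $r$-uniform hypergraph $H$ with chromatic number $\chi(H) > t$ contains a copy of every $r$-uniform hypertree with $t$ edges.
   Context: Hypergraphs are finite. An $r$-uniform hypergraph ($r$-graph) is a hypergraph all of whose edges have exactly $r$ vertices. A proper coloring of a hypergraph is an assignment of a color to each vertex such that no edge is monochromatic; the chromatic number $\chi(H)$ is the minimum $k$ for which $H$ has a proper coloring with $k$ colors. An $r$-uniform hypertree ($r$-tree) is a connected $r$-uniform hypergraph in which no two edges intersect in more than one vertex, and which has no sequence of distinct vertices and distinct edges $(v_1, e_1, v_2, e_2, \ldots, v_k, e_k)$ (with $k \ge 2$) such that $\{v_i, v_{i+1}\} \subseteq e_i$ for all $i$, where $v_{k+1} = v_1$. $H$ contains a copy of $T$ if there is an injective map from the vertex set of $T$ to the vertex set of $H$ that maps every edge of $T$ onto an edge of $H$. *)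

theory Defs
  imports Main
begin

text \<open>A hypergraph is given by its vertex set \<open>V\<close> and its edge set \<open>E\<close>; parallel edges do not
  occur, isolated vertices may.\<close>

definition hypergraph :: "'a set \<Rightarrow> 'a set set \<Rightarrow> bool" where
  "hypergraph V E \<longleftrightarrow> finite V \<and> (\<forall>e\<in>E. e \<subseteq> V)"

definition uniform_hypergraph :: "nat \<Rightarrow> 'a set \<Rightarrow> 'a set set \<Rightarrow> bool" where
  "uniform_hypergraph r V E \<longleftrightarrow> hypergraph V E \<and> (\<forall>e\<in>E. card e = r)"

definition monochromatic :: "('a \<Rightarrow> 'c) \<Rightarrow> 'a set \<Rightarrow> bool" where
  "monochromatic c e \<longleftrightarrow> (\<exists>a. \<forall>v\<in>e. c v = a)"

definition proper_coloring :: "'a set \<Rightarrow> 'a set set \<Rightarrow> nat \<Rightarrow> ('a \<Rightarrow> nat) \<Rightarrow> bool" where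
  "proper_coloring V E k c \<longleftrightarrow> c ` V \<subseteq> {..<k} \<and> (\<forall>e\<in>E. \<not> monochromatic c e)"

text \<open>The minimum exists as soon as every edge has at least two vertices, see
  \<open>ex_proper_coloring\<close> below; without a proper coloring the value is unspecified.\<close>

definition chromatic_number :: "'a set \<Rightarrow> 'a set set \<Rightarrow> nat" where
  "chromatic_number V E = (LEAST k. \<exists>c. proper_coloring V E k c)"

definition connected_hypergraph :: "'a set \<Rightarrow> 'a set set \<Rightarrow> bool" where
  "connected_hypergraph V E \<longleftrightarrow>
     (\<forall>u\<in>V. \<forall>v\<in>V. (u, v) \<in> {(x, y). \<exists>e\<in>E. x \<in> e \<and> y \<in> e}\<^sup>*)"

definition linear_hypergraph :: "'a set set \<Rightarrow> bool" where
  "linear_hypergraph E \<longleftrightarrow> (\<forall>e\<in>E. \<forall>f\<in>E. e \<noteq> f \<longrightarrow> card (e \<inter> f) \<le> 1)"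

text \<open>The lists hold \<open>v\<^sub>1, \<dots>, v\<^sub>k\<close> and \<open>e\<^sub>1, \<dots>, e\<^sub>k\<close>, indexed from 0; the index of
  \<open>v\<^bsub>i+1\<^esub>\<close> is taken modulo \<open>k\<close>.\<close>

definition hypergraph_cycle :: "'a set set \<Rightarrow> 'a list \<Rightarrow> 'a set list \<Rightarrow> bool" where
  "hypergraph_cycle E vs es \<longleftrightarrow>
     length vs = length es \<and> length vs \<ge> 2 \<and> distinct vs \<and> distinct es \<and> set es \<subseteq> E \<and>
     (\<forall>i<length vs. {vs ! i, vs ! (Suc i mod length vs)} \<subseteq> es ! i)"

definition hypertree :: "nat \<Rightarrow> 'a set \<Rightarrow> 'a set set \<Rightarrow> bool" where
  "hypertree r V E \<longleftrightarrow>
     uniform_hypergraph r V E \<and> connected_hypergraph V E \<and> linear_hypergraph E \<and>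
     (\<nexists>vs es. hypergraph_cycle E vs es)"

definition contains_copy :: "'a set \<Rightarrow> 'a set set \<Rightarrow> 'b set \<Rightarrow> 'b set set \<Rightarrow> bool" where
  "contains_copy V E W F \<longleftrightarrow>
     (\<exists>f. inj_on f W \<and> f ` W \<subseteq> V \<and> (\<forall>e\<in>F. f ` e \<in> E))"

lemma ex_proper_coloring:
  assumes "uniform_hypergraph r V E" and "r \<ge> 2"
  shows "\<exists>k c. proper_coloring V E k c"
proof -
  have V: "finite V" and E: "\<And>e. e \<in> E \<Longrightarrow> e \<subseteq> V \<and> card e = r"
    using assms(1) by (auto simp: uniform_hypergraph_def hypergraph_def)
  obtain c :: "'a \<Rightarrow> nat" where c: "inj_on c V" "c ` V \<subseteq> {..<card V}"
    using ex_bij_betw_finite_nat[OF V] by (auto simp: bij_betw_def atLeast0LessThan)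
  have "\<not> monochromatic c e" if "e \<in> E" for e
  proof
    assume "monochromatic c e"
    then obtain a where "\<forall>v\<in>e. c v = a"
      by (auto simp: monochromatic_def)
    then have "\<forall>x\<in>e. \<forall>y\<in>e. x = y"
      using c(1) E[OF that] by (auto simp: inj_on_def subset_iff)
    then have "card e \<le> Suc 0"
      using card_le_Suc0_iff_eq[of e] E[OF that] V by (auto intro: finite_subset)
    then show False
      using E[OF that] assms(2) by simp
  qed
  then show ?thesis
    using c(2) unfolding proper_coloring_def by blast
qed

end

theory Submission
  imports Defs
begin

text \<open>
  Let \<open>I\<close> be a maximal independent set of \<open>H\<close>. Giving \<open>I\<close> one extra color shows that
  \<open>\<chi>(H - I) \<ge> \<chi>(H) - 1\<close>, so by induction \<open>H - I\<close> contains the tree without a leaf edge. Every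
  vertex \<open>x\<close> outside \<open>I\<close> lies, by maximality, in an edge whose other vertices all belong to
  \<open>I\<close>; these are disjoint from the copy found so far, so this edge can serve as the leaf edge at \<open>x\<close>.
\<close>

section \<open>Grown trees and paths\<close>

text \<open>Hypertrees in a form that admits rule induction. The condition
  \<open>e \<notin> G\<close> makes every attached edge raise \<open>card G\<close> by one, so that
  edges can be traded for colors.\<close>

inductive grown_tree :: "nat \<Rightarrow> 'b set \<Rightarrow> 'b set set \<Rightarrow> bool" for r where
  root: "grown_tree r {v} {}"
| leaf: "grown_tree r (U \<union> e) (insert e G)"
    if "grown_tree r U G" "card e = r" "e \<inter> U = {v}" "e \<notin> G"

text \<open>The open counterpart of \<open>hypergraph_cycle\<close>, with one vertex more than edges
  instead of a wrap-around, so that appending one edge to \<open>es\<close> closes it. For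
  \<open>x = y\<close> only the path \<open>[x]\<close> without edges remains.\<close>

definition hypergraph_path :: "'b set set \<Rightarrow> 'b \<Rightarrow> 'b \<Rightarrow> 'b list \<Rightarrow> 'b set list \<Rightarrow> bool" where
  "hypergraph_path G x y vs es \<longleftrightarrow>
     length vs = Suc (length es) \<and> vs ! 0 = x \<and> vs ! length es = y \<and>
     distinct vs \<and> distinct es \<and> set es \<subseteq> G \<and>
     (\<forall>i<length es. {vs ! i, vs ! Suc i} \<subseteq> es ! i)"

lemma hypergraph_path_edge:
  assumes "x \<in> e" "y \<in> e" "x \<noteq> y" "e \<in> G"
  shows "hypergraph_path G x y [x, y] [e]"
  using assms by (auto simp: hypergraph_path_def)

lemma hypergraph_path_Cons:
  assumes p: "hypergraph_path G v y vs es"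
    and e: "x \<in> e" "v \<in> e" "x \<notin> set vs" "e \<notin> G"
  shows "hypergraph_path (insert e G) x y (x # vs) (e # es)"
proof -
  have "{(x # vs) ! i, (x # vs) ! Suc i} \<subseteq> (e # es) ! i" if "i < length (e # es)" for i
    using that p e by (cases i) (auto simp: hypergraph_path_def)
  then show ?thesis
    using p e unfolding hypergraph_path_def by auto
qed

lemma hypergraph_path_rev:
  assumes p: "hypergraph_path G x y vs es"
  shows "hypergraph_path G y x (rev vs) (rev es)"
proof -
  have "{rev vs ! i, rev vs ! Suc i} \<subseteq> rev es ! i" if "i < length es" for i
  proof -
    \<comment> \<open>Edge \<open>i\<close> of the reversed path is edge \<open>j\<close> of the old
      one, run backwards.\<close>
    define j where "j = length es - Suc i"
    have "j < length es" "rev es ! i = es ! j" "rev vs ! i = vs ! Suc j" "rev vs ! Suc i = vs ! j"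
      using that p by (auto simp: j_def rev_nth hypergraph_path_def Suc_diff_Suc)
    then show ?thesis
      using p by (auto simp: hypergraph_path_def)
  qed
  then show ?thesis
    using p by (auto simp: hypergraph_path_def rev_nth)
qed

text \<open>A path without edges may sit at a vertex outside all edges of \<open>G\<close>;
  \<open>x \<noteq> y\<close> excludes this.\<close>

lemma hypergraph_path_vertices:
  assumes p: "hypergraph_path G x y vs es" and "x \<noteq> y"
  shows "set vs \<subseteq> \<Union>G"
proof
  fix z assume "z \<in> set vs"
  then obtain i where i: "i < length vs" "z = vs ! i"
    by (auto simp: in_set_conv_nth)
  have "es \<noteq> []"
    using assms by (auto simp: hypergraph_path_def)
  \<comment> \<open>The first vertex lies in the first edge, every later one in the edge leading to
    it.\<close>
  then have "\<exists>j<length es. z \<in> es ! j"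
    using i p by (cases i) (auto simp: hypergraph_path_def)
  then obtain j where "j < length es" "z \<in> es ! j"
    by blast
  moreover have "set es \<subseteq> G"
    using p by (simp add: hypergraph_path_def)
  ultimately show "z \<in> \<Union>G"
    using nth_mem by blast
qed

lemma hypergraph_path_cycle:
  assumes p: "hypergraph_path G x y vs es" and "x \<noteq> y"
    and e: "x \<in> e" "y \<in> e" "e \<notin> G"
  shows "hypergraph_cycle (insert e G) vs (es @ [e])"
proof -
  \<comment> \<open>At the last index \<open>Suc i mod length vs\<close> is 0, and the closing edge
    \<open>e\<close> contains both endpoints.\<close>
  have "{vs ! i, vs ! (Suc i mod length vs)} \<subseteq> (es @ [e]) ! i" if "i < length vs" for i
    using that p e by (cases "i = length es") (auto simp: hypergraph_path_def nth_append)
  moreover have "es \<noteq> []"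
    using assms by (auto simp: hypergraph_path_def)
  ultimately show ?thesis
    using p e by (cases es) (auto simp: hypergraph_path_def hypergraph_cycle_def)
qed

lemma grown_tree_edge_subset: "grown_tree r U G \<Longrightarrow> e \<in> G \<Longrightarrow> e \<subseteq> U"
  by (induction rule: grown_tree.induct) auto

lemma grown_tree_finite_edges: "grown_tree r U G \<Longrightarrow> finite G"
  by (induction rule: grown_tree.induct) auto

lemma hypergraph_path_mono:
  "hypergraph_path G x y vs es \<Longrightarrow> G \<subseteq> G' \<Longrightarrow> hypergraph_path G' x y vs es"
  by (auto simp: hypergraph_path_def)

lemma grown_tree_path:
  assumes "grown_tree r U G" "x \<in> U" "y \<in> U" "x \<noteq> y"
  shows "\<exists>vs es. hypergraph_path G x y vs es"
  using assms
proof (induction arbitrary: x y rule: grown_tree.induct)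
  case (root v)
  then show ?case by simp
next
  case (leaf U G e v)
  \<comment> \<open>From a new vertex \<open>a\<close>, cross \<open>e\<close> to the attachment
    vertex \<open>v\<close> and follow a path of \<open>G\<close> from there to
    \<open>b\<close>.\<close>
  have new: "\<exists>vs es. hypergraph_path (insert e G) a b vs es"
    if ab: "a \<in> e" "a \<notin> U" "b \<in> U" "b \<notin> e" for a b
  proof -
    have "v \<in> U" "v \<in> e" "v \<noteq> b"
      using leaf.hyps ab by auto
    then obtain vs es where p: "hypergraph_path G v b vs es"
      using leaf.IH ab by blast
    \<comment> \<open>The vertices of the path lie in edges of \<open>G\<close>, hence in
      \<open>U\<close>.\<close>
    have "a \<notin> set vs"
      using hypergraph_path_vertices[OF p \<open>v \<noteq> b\<close>] grown_tree_edge_subset[OF leaf.hyps(1)] ab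
      by blast
    then show ?thesis
      using hypergraph_path_Cons[OF p] ab \<open>v \<in> e\<close> leaf.hyps by blast
  qed
  \<comment> \<open>Pairs within \<open>e\<close> are joined by \<open>e\<close> itself, so in the
    mixed cases the old endpoint differs from \<open>v\<close>.\<close>
  consider "x \<in> e" "y \<in> e" | "x \<in> U" "y \<in> U" | "x \<in> e" "x \<notin> U" "y \<in> U" "y \<notin> e"
    | "y \<in> e" "y \<notin> U" "x \<in> U" "x \<notin> e"
    using leaf.prems by blast
  then show ?case
  proof cases
    case 1
    then show ?thesis using hypergraph_path_edge leaf.prems by (metis insertI1)
  next
    case 2
    then show ?thesis using leaf.IH leaf.prems hypergraph_path_mono by (metis subset_insertI)
  next
    case 3
    then show ?thesis by (rule new)
  next
    case 4
    then show ?thesis using new hypergraph_path_rev by metis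
  qed
qed

section \<open>From hypertrees to grown trees\<close>

text \<open>A maximal grown subtree is everything: acyclicity lets each further edge meet it in at
  most one vertex, and connectedness supplies an edge to attach as long as vertices are missing. The
  empty hypergraph satisfies \<open>hypertree\<close> but has no root, hence
  \<open>W \<noteq> {}\<close>.\<close>

lemma hypertree_grown_tree:
  assumes T: "hypertree r W F" and "r \<ge> 2" and "W \<noteq> {}"
  shows "grown_tree r W F"
proof -
  have W: "finite W" and F: "\<And>e. e \<in> F \<Longrightarrow> e \<subseteq> W \<and> card e = r"
    and conn: "connected_hypergraph W F" and acyclic: "\<nexists>vs es. hypergraph_cycle F vs es"
    using T by (auto simp: hypertree_def uniform_hypergraph_def hypergraph_def)
  have "F \<subseteq> Pow W"
    using F by auto
  then have "finite F"
    using W by (simp add: finite_subset)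
  define \<G> where "\<G> = {G. G \<subseteq> F \<and> (\<exists>U\<subseteq>W. grown_tree r U G)}"
  have "finite \<G>"
    using \<open>finite F\<close> by (simp add: \<G>_def)
  moreover have "{} \<in> \<G>"
    using \<open>W \<noteq> {}\<close> by (auto simp: \<G>_def intro: grown_tree.root)
  ultimately obtain G where "G \<in> \<G>" and max: "\<And>G'. G' \<in> \<G> \<Longrightarrow> G \<subseteq> G' \<Longrightarrow> G = G'"
    using finite_has_maximal2 by metis
  then obtain U where G: "G \<subseteq> F" "U \<subseteq> W" "grown_tree r U G"
    by (auto simp: \<G>_def)
  \<comment> \<open>Two common vertices are joined by a path in \<open>G\<close>, which
    \<open>e\<close> would close to a cycle.\<close>
  have at_most_one: "x = y" if e: "e \<in> F - G" and xy: "x \<in> e" "y \<in> e" "x \<in> U" "y \<in> U" for e x y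
  proof (rule ccontr)
    assume "x \<noteq> y"
    then obtain vs es where "hypergraph_path G x y vs es"
      using grown_tree_path[OF G(3)] xy by blast
    then have "hypergraph_cycle (insert e G) vs (es @ [e])"
      using hypergraph_path_cycle \<open>x \<noteq> y\<close> xy e by (metis DiffD2)
    then have "hypergraph_cycle F vs (es @ [e])"
      using G e by (auto simp: hypergraph_cycle_def)
    then show False
      using acyclic by blast
  qed
  have "U \<noteq> {}"
    using G(3) by (induction rule: grown_tree.induct) auto
  have "U = W"
  proof (rule ccontr)
    assume "U \<noteq> W"
    then obtain u w where "u \<in> U" "w \<in> W" "w \<notin> U"
      using G \<open>U \<noteq> {}\<close> by blast
    then have "(u, w) \<in> {(x, y). \<exists>e\<in>F. x \<in> e \<and> y \<in> e}\<^sup>*"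
      using conn G by (auto simp: connected_hypergraph_def)
    \<comment> \<open>A walk from \<open>u\<close> to \<open>w\<close> must leave \<open>U\<close>
      at some step.\<close>
    then have "\<exists>e\<in>F. \<exists>x\<in>e \<inter> U. \<not> e \<subseteq> U"
      using \<open>u \<in> U\<close> \<open>w \<notin> U\<close> by (induction rule: rtrancl_induct) auto
    then obtain e x where e: "e \<in> F" "x \<in> e" "x \<in> U" "\<not> e \<subseteq> U"
      by blast
    then have "e \<notin> G"
      using grown_tree_edge_subset G by blast
    then have "e \<inter> U = {x}"
      using at_most_one e by blast
    then have "grown_tree r (U \<union> e) (insert e G)"
      using grown_tree.leaf G F e \<open>e \<notin> G\<close> by metis
    moreover have "U \<union> e \<subseteq> W" "insert e G \<subseteq> F"
      using G F[OF e(1)] e by auto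
    ultimately have "insert e G \<in> \<G>"
      unfolding \<G>_def by blast
    then show False
      using max \<open>e \<notin> G\<close> by blast
  qed
  moreover have "F = G"
  proof (rule ccontr)
    assume "F \<noteq> G"
    then obtain e where e: "e \<in> F - G"
      using G by blast
    then have "e \<subseteq> W" "card e = r"
      using F by auto
    \<comment> \<open>Now all vertices of \<open>e\<close> lie in \<open>U\<close>, so
      \<open>at_most_one\<close> applies to the whole edge.\<close>
    then have "finite e" "\<forall>x\<in>e. \<forall>y\<in>e. x = y"
      using at_most_one[OF e] W \<open>U = W\<close> by (blast intro: finite_subset)+
    then have "card e \<le> Suc 0"
      by (simp add: card_le_Suc0_iff_eq)
    then show False
      using \<open>card e = r\<close> \<open>r \<ge> 2\<close> by simp
  qed
  ultimately show ?thesis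
    using G by simp
qed

section \<open>Independent sets and colorings\<close>

lemma ex_maximal_independent:
  assumes "uniform_hypergraph r V E" "r > 0"
  obtains I where "I \<subseteq> V" "\<forall>e\<in>E. \<not> e \<subseteq> I"
    "\<And>x. x \<in> V - I \<Longrightarrow> \<exists>e\<in>E. x \<in> e \<and> e - {x} \<subseteq> I"
proof -
  define \<I> where "\<I> = {I. I \<subseteq> V \<and> (\<forall>e\<in>E. \<not> e \<subseteq> I)}"
  have "finite \<I>"
    using assms by (simp add: \<I>_def uniform_hypergraph_def hypergraph_def)
  moreover have "{} \<in> \<I>"
    using assms by (auto simp: \<I>_def uniform_hypergraph_def)
  ultimately obtain I where "I \<in> \<I>" and max: "\<And>J. J \<in> \<I> \<Longrightarrow> I \<subseteq> J \<Longrightarrow> I = J"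
    using finite_has_maximal2 by metis
  have "\<exists>e\<in>E. x \<in> e \<and> e - {x} \<subseteq> I" if x: "x \<in> V - I" for x
  proof -
    \<comment> \<open>By maximality \<open>insert x I\<close> contains an edge; as \<open>I\<close>
      contains none, that edge passes through \<open>x\<close>.\<close>
    have "insert x I \<notin> \<I>"
      using max x by blast
    then obtain e where "e \<in> E" "e \<subseteq> insert x I"
      using \<open>I \<in> \<I>\<close> x by (auto simp: \<I>_def)
    then show ?thesis
      using \<open>I \<in> \<I>\<close> unfolding \<I>_def by blast
  qed
  moreover have "I \<subseteq> V" "\<forall>e\<in>E. \<not> e \<subseteq> I"
    using \<open>I \<in> \<I>\<close> by (auto simp: \<I>_def)
  ultimately show ?thesis
    using that by blast
qed

text \<open>The color \<open>k\<close> is new, so an edge colored only with \<open>k\<close> would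
  lie in \<open>I\<close>. An edge in any other single color would avoid \<open>I\<close> and
  already be monochromatic under \<open>c\<close>.\<close>

lemma proper_coloring_add_independent:
  assumes c: "proper_coloring (V - I) {e \<in> E. e \<subseteq> V - I} k c"
    and I: "\<forall>e\<in>E. \<not> e \<subseteq> I" and E: "\<forall>e\<in>E. e \<subseteq> V"
  shows "proper_coloring V E (Suc k) (\<lambda>v. if v \<in> I then k else c v)"
proof -
  let ?c = "\<lambda>v. if v \<in> I then k else c v"
  have less: "c v < k" if "v \<in> V - I" for v
    using c that by (auto simp: proper_coloring_def)
  have "\<not> monochromatic ?c e" if "e \<in> E" for e
  proof
    assume "monochromatic ?c e"
    then obtain a where a: "\<And>v. v \<in> e \<Longrightarrow> ?c v = a"
      unfolding monochromatic_def by blast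
    show False
    proof (cases "a = k")
      case True
      then have "v \<in> I" if "v \<in> e" for v
        using a[OF that] less[of v] E \<open>e \<in> E\<close> that by (auto split: if_splits)
      then show False
        using I \<open>e \<in> E\<close> by blast
    next
      case False
      then have av: "v \<notin> I \<and> c v = a" if "v \<in> e" for v
        using a[OF that] by (auto split: if_splits)
      then have "e \<in> {e \<in> E. e \<subseteq> V - I}"
        using E \<open>e \<in> E\<close> by blast
      then show False
        using av c by (auto simp: proper_coloring_def monochromatic_def)
    qed
  qed
  moreover have "?c ` V \<subseteq> {..<Suc k}"
    using less by (auto simp: less_Suc_eq)
  ultimately show ?thesis
    by (simp add: proper_coloring_def)
qed

section \<open>Embedding grown trees\<close>

text \<open>Each induction step spends one edge and one color on passing to \<open>V - I\<close>, so
  \<open>V\<close> and \<open>E\<close> stay arbitrary. The absence of colorings with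
  \<open>card G\<close> colors is inherited directly, without going through
  \<open>chromatic_number\<close>.\<close>

lemma grown_tree_embeds:
  assumes "grown_tree r U G" "r > 0" "uniform_hypergraph r V E"
    and "\<nexists>c. proper_coloring V E (card G) c"
  shows "contains_copy V E U G"
  using assms
proof (induction arbitrary: V E rule: grown_tree.induct)
  case (root v)
  \<comment> \<open>Without vertices there are no edges, as \<open>r > 0\<close>, and zero colors
    would suffice.\<close>
  have "V \<noteq> {}"
  proof
    assume "V = {}"
    then have "E = {}"
      using root.prems by (fastforce simp: uniform_hypergraph_def hypergraph_def)
    then show False
      using root.prems \<open>V = {}\<close> by (simp add: proper_coloring_def)
  qed
  then obtain x where "x \<in> V"
    by blast
  then show ?case
    unfolding contains_copy_def by (intro exI[of _ "\<lambda>_. x"]) auto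
next
  case (leaf U G e v)
  have E: "\<forall>e\<in>E. e \<subseteq> V \<and> card e = r" and "finite V"
    using leaf.prems by (auto simp: uniform_hypergraph_def hypergraph_def)
  obtain I where I: "I \<subseteq> V" "\<forall>e\<in>E. \<not> e \<subseteq> I"
    and max: "\<And>x. x \<in> V - I \<Longrightarrow> \<exists>e\<in>E. x \<in> e \<and> e - {x} \<subseteq> I"
    using ex_maximal_independent leaf.prems by blast
  let ?E' = "{e \<in> E. e \<subseteq> V - I}"
  have "card (insert e G) = Suc (card G)"
    using grown_tree_finite_edges leaf.hyps by (metis card_insert_disjoint)
  then have "\<not> proper_coloring (V - I) ?E' (card G) c" for c
    using proper_coloring_add_independent[of V I E "card G" c] I(2) E leaf.prems(3) by auto
  moreover have "uniform_hypergraph r (V - I) ?E'"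
    using leaf.prems by (auto simp: uniform_hypergraph_def hypergraph_def)
  ultimately have "contains_copy (V - I) ?E' U G"
    using leaf.IH leaf.prems(1) by blast
  then obtain f where f: "inj_on f U" "f ` U \<subseteq> V - I" "\<forall>d\<in>G. f ` d \<in> ?E'"
    unfolding contains_copy_def by blast
  have v: "v \<in> e" "v \<in> U"
    using leaf.hyps by auto
  \<comment> \<open>\<open>f v\<close> lies outside \<open>I\<close>, so maximality applies to
    it.\<close>
  then obtain h where h: "h \<in> E" "f v \<in> h" "h - {f v} \<subseteq> I"
    using max f by blast
  have "finite h" "finite e"
    using h E \<open>finite V\<close> leaf.hyps leaf.prems by (auto intro: finite_subset card_ge_0_finite)
  \<comment> \<open>Both sets have \<open>r - 1\<close> elements.\<close>
  moreover have "card (e - {v}) = card (h - {f v})"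
    using v h E leaf.hyps by simp
  ultimately obtain g where g: "bij_betw g (e - {v}) (h - {f v})"
    using finite_same_card_bij by blast
  \<comment> \<open>On the shared vertex \<open>v\<close> the map keeps the value
    \<open>f v\<close>; only the new vertices of \<open>e\<close> go through
    \<open>g\<close>.\<close>
  define f' where "f' x = (if x \<in> U then f x else g x)" for x
  have f'_U: "f' ` d = f ` d" if "d \<subseteq> U" for d
    using that by (auto simp: f'_def intro!: image_cong)
  have f'_new: "f' x = g x" if "x \<in> e - {v}" for x
    using that leaf.hyps by (auto simp: f'_def)
  have f'_leaf: "f' ` (e - {v}) = h - {f v}"
    using g f'_new by (auto simp: bij_betw_def)
  have "e = insert v (e - {v})"
    using v by blast
  then have "f' ` e = insert (f' v) (f' ` (e - {v}))"
    by (metis image_insert)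
  then have "f' ` e = h"
    using f'_leaf v h by (auto simp: f'_def)
  have "inj_on f' U"
    using f by (auto simp: f'_def inj_on_def)
  moreover have "inj_on f' (e - {v})"
    using g f'_new by (auto simp: bij_betw_def inj_on_def)
  \<comment> \<open>The old copy avoids \<open>I\<close>, while the rest of \<open>h\<close> lies in
    \<open>I\<close>.\<close>
  moreover have "f' ` U \<inter> f' ` (e - {v}) = {}"
    using f'_U[of U] f'_leaf f h by blast
  ultimately have "inj_on f' (U \<union> (e - {v}))"
    unfolding inj_on_Un by blast
  moreover have "U \<union> (e - {v}) = U \<union> e"
    using v by blast
  ultimately have "inj_on f' (U \<union> e)"
    by simp
  moreover have "f' ` (U \<union> e) \<subseteq> V"
    using \<open>f' ` e = h\<close> f'_U[of U] f h E by (auto simp: image_Un)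
  moreover have "f' ` d \<in> E" if "d \<in> insert e G" for d
    using that \<open>f' ` e = h\<close> h f f'_U[OF grown_tree_edge_subset[OF leaf.hyps(1)]] by auto
  ultimately show ?case
    unfolding contains_copy_def by blast
qed

theorem theorem1:
  fixes r t :: nat
    and V :: "'a set" and E :: "'a set set"
    and W :: "'b set" and F :: "'b set set"
  assumes "r \<ge> 2" and "t \<ge> 1"
    and "uniform_hypergraph r V E"
    and "chromatic_number V E > t"
    and "hypertree r W F" and "card F = t"
  shows "contains_copy V E W F"
proof -
  have "F \<noteq> {}"
    using assms(2,6) by auto
  then have "W \<noteq> {}"
    using assms(1,5) by (fastforce simp: hypertree_def uniform_hypergraph_def hypergraph_def)
  then have "grown_tree r W F"
    using hypertree_grown_tree assms(1,5) by blast
  \<comment> \<open>\<open>card F\<close> is below the least number of colors that works, so no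
    monotonicity in the number of colors is involved.\<close>
  moreover have "\<nexists>c. proper_coloring V E (card F) c"
    using not_less_Least assms(4,6) unfolding chromatic_number_def by blast
  ultimately show ?thesis
    using grown_tree_embeds assms(1,3) by (metis not_numeral_le_zero neq0_conv)
qed

end
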